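(* There exist a reproducing kernel Hilbert space $\mathcal{H}$ on a set $X$ and a linear functional $\Lambda:\mathcal{H}\to\mathbb{C}$ with the following properties: (i) The reproducing kernel $K:X\times X\to\mathbb{C}$ associated to $\mathcal{H}$ is normalized, and satisfies $K(x,y)\neq 0$ for all $x,y\in X$. (ii) The linear functional $\Lambda$ satisfies $\Lambda(1)=1$ and $\Lambda(f)\neq 0$ for all cyclic elements $f\in\mathcal{H}$. Furthermore $\Lambda$ is continuous on $\mathcal{H}$. (iii) There exists a multiplier $h$ of $\mathcal{H}$ such that $\Lambda(h^2)\neq\Lambda(h)^2$.
   Context: A reproducing kernel Hilbert space (RKHS) on a set $X$ is a complex Hilbert space $\mathcal{H}$ of functions $X\to\mathbb{C}$ (with pointwise operations) such that, for each $x\in X$, the evaluation functional $f\mapsto f(x)$ is continuous on $\mathcal{H}$. For $x\in X$ let $k_x\in\mathcal{H}$ be the unique element with $f(x)=\langle f,k_x\rangle$ for all $f\in\mathcal{H}$. The reproducing kernel of $\mathcal{H}$ is $K:X\times X\to\mathbb{C}$, $K(x,y):=k_y(x)=\langle k_y,k_x\rangle$. It is always assumed that $K(x,x)>0$ for all $x\in X$. The kernel $K$ is normalized if there exists $x_0\in X$ such that $K(x,x_0)=1$ for all $x\in X$. In that case $\mathcal{H}$ contains the constant functions; $1$ denotes the constant function with value $1$. A multiplier of $\mathcal{H}$ is a function $h:X\to\mathbb{C}$ such that $hf\in\mathcal{H}$ for all $f\in\mathcal{H}$; $\mathcal{M}$ denotes the set of multipliers. When $K$ is normalized, $\mathcal{M}\subset\mathcal{H}$.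 An element $f\in\mathcal{H}$ is cyclic if the closure in $\mathcal{H}$ of $\mathcal{M}f=\{hf:h\in\mathcal{M}\}$ is all of $\mathcal{H}$. Products of functions are pointwise. *)

theory Defs
  imports "HOL-Analysis.Analysis"
begin

text \<open>
  A function on a set \<open>X\<close> is represented by the total function that agrees with it on \<open>X\<close> and
  vanishes outside \<open>X\<close>.  The representation is unique and respects pointwise linear combinations
  and products; the constant function one becomes the indicator function of \<open>X\<close>.
\<close>

definition funs_on :: "'a set \<Rightarrow> ('a \<Rightarrow> complex) set" where
  "funs_on X = {f. \<forall>x. x \<notin> X \<longrightarrow> f x = 0}"

definition one_on :: "'a set \<Rightarrow> 'a \<Rightarrow> complex" where
  "one_on X = (\<lambda>x. if x \<in> X then 1 else 0)"

type_synonym 'a inner = "('a \<Rightarrow> complex) \<Rightarrow> ('a \<Rightarrow> complex) \<Rightarrow> complex"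

definition hnorm :: "'a inner \<Rightarrow> ('a \<Rightarrow> complex) \<Rightarrow> real" where
  "hnorm ip f = sqrt (Re (ip f f))"

text \<open>
  The value outside \<open>H\<close> is irrelevant; it is set to 0 because the library's metric spaces
  require a globally non-negative and symmetric distance function.
\<close>

definition hdist :: "('a \<Rightarrow> complex) set \<Rightarrow> 'a inner \<Rightarrow> ('a \<Rightarrow> complex) \<Rightarrow> ('a \<Rightarrow> complex) \<Rightarrow> real" where
  "hdist H ip f g = (if f \<in> H \<and> g \<in> H then hnorm ip (\<lambda>x. f x - g x) else 0)"

definition htopology :: "('a \<Rightarrow> complex) set \<Rightarrow> 'a inner \<Rightarrow> ('a \<Rightarrow> complex) topology" where
  "htopology H ip = Metric_space.mtopology H (hdist H ip)"

text \<open>Inner products are linear in the first argument.\<close>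

locale inner_function_space =
  fixes X :: "'a set" and H :: "('a \<Rightarrow> complex) set" and ip :: "'a inner"
  assumes subset_funs_on: "H \<subseteq> funs_on X"
    and zero_mem: "(\<lambda>_. 0) \<in> H"
    and add_mem: "f \<in> H \<Longrightarrow> g \<in> H \<Longrightarrow> (\<lambda>x. f x + g x) \<in> H"
    and scale_mem: "f \<in> H \<Longrightarrow> (\<lambda>x. c * f x) \<in> H"
    and ip_add: "f \<in> H \<Longrightarrow> g \<in> H \<Longrightarrow> k \<in> H \<Longrightarrow> ip (\<lambda>x. f x + g x) k = ip f k + ip g k"
    and ip_scale: "f \<in> H \<Longrightarrow> g \<in> H \<Longrightarrow> ip (\<lambda>x. c * f x) g = c * ip f g"
    and ip_cnj: "f \<in> H \<Longrightarrow> g \<in> H \<Longrightarrow> ip g f = cnj (ip f g)"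
    and ip_pos: "f \<in> H \<Longrightarrow> f \<noteq> (\<lambda>_. 0) \<Longrightarrow> 0 < Re (ip f f)"
begin

lemma ip_add_right:
  assumes "f \<in> H" "g \<in> H" "k \<in> H"
  shows "ip k (\<lambda>x. f x + g x) = ip k f + ip k g"
  using ip_cnj[OF add_mem[OF assms(1,2)] assms(3)] ip_cnj[OF assms(1,3)] ip_cnj[OF assms(2,3)]
  by (simp add: ip_add[OF assms])

lemma ip_scale_right:
  assumes "f \<in> H" "g \<in> H"
  shows "ip g (\<lambda>x. c * f x) = cnj c * ip g f"
  using ip_cnj[OF scale_mem[OF assms(1)] assms(2)] ip_cnj[OF assms]
  by (simp add: ip_scale[OF assms])

lemma diff_mem:
  assumes "f \<in> H" "g \<in> H"
  shows "(\<lambda>x. f x - g x) \<in> H"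
  using add_mem[OF assms(1) scale_mem[OF assms(2), of "-1"]] by simp

lemma ip_zero [simp]: "f \<in> H \<Longrightarrow> ip (\<lambda>_. 0) f = 0"
  using ip_scale[OF zero_mem, of f 0] by simp

lemma ip_nonneg: "f \<in> H \<Longrightarrow> 0 \<le> Re (ip f f)"
  using ip_pos[of f] by (cases "f = (\<lambda>_. 0)") (auto simp: zero_mem less_imp_le)

lemma hnorm_nonneg: "f \<in> H \<Longrightarrow> 0 \<le> hnorm ip f"
  by (simp add: hnorm_def ip_nonneg)

lemma hnorm_square: "f \<in> H \<Longrightarrow> (hnorm ip f)\<^sup>2 = Re (ip f f)"
  by (simp add: hnorm_def ip_nonneg)

lemma hnorm_eq_0_iff: "f \<in> H \<Longrightarrow> hnorm ip f = 0 \<longleftrightarrow> f = (\<lambda>_. 0)"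
  using ip_pos[of f] ip_zero[OF zero_mem] by (cases "f = (\<lambda>_. 0)") (auto simp: hnorm_def)

lemma hnorm_square_combination:
  fixes a b :: real
  assumes "f \<in> H" "g \<in> H"
  shows "(hnorm ip (\<lambda>x. of_real a * f x + of_real b * g x))\<^sup>2
    = a\<^sup>2 * (hnorm ip f)\<^sup>2 + 2 * a * b * Re (ip f g) + b\<^sup>2 * (hnorm ip g)\<^sup>2"
proof -
  let ?f = "\<lambda>x. of_real a * f x" and ?g = "\<lambda>x. of_real b * g x"
  have mem: "?f \<in> H" "?g \<in> H" "(\<lambda>x. ?f x + ?g x) \<in> H"
    using assms by (auto intro: add_mem scale_mem)
  have "ip (\<lambda>x. ?f x + ?g x) (\<lambda>x. ?f x + ?g x) = ip ?f ?f + ip ?f ?g + (ip ?g ?f + ip ?g ?g)"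
    by (simp only: ip_add[OF mem] ip_add_right[OF mem(1,2,1)] ip_add_right[OF mem(1,2,2)])
  also have "\<dots> = of_real (a\<^sup>2) * ip f f + of_real (a * b) * ip f g
      + (of_real (a * b) * cnj (ip f g) + of_real (b\<^sup>2) * ip g g)"
    using assms mem ip_cnj[OF assms]
    by (simp add: ip_scale ip_scale_right power2_eq_square)
  finally show ?thesis
    by (simp add: hnorm_square assms mem algebra_simps)
qed

lemma Re_ip_le:
  assumes "f \<in> H" "g \<in> H"
  shows "Re (ip f g) \<le> hnorm ip f * hnorm ip g"
proof (cases "hnorm ip f * hnorm ip g = 0")
  case True
  then have "f = (\<lambda>_. 0) \<or> g = (\<lambda>_. 0)"
    using assms by (simp add: hnorm_eq_0_iff)
  then have "ip f g = 0"
    using assms ip_cnj[of g f] by auto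
  then show ?thesis unfolding True by simp
next
  case False
  define a where "a = hnorm ip f"
  define b where "b = hnorm ip g"
  have ab: "0 < a * b"
    using False assms hnorm_nonneg by (simp add: a_def b_def less_le)
  have "0 \<le> b\<^sup>2 * a\<^sup>2 + 2 * b * (- a) * Re (ip f g) + (- a)\<^sup>2 * b\<^sup>2"
    using hnorm_square_combination[OF assms, of b "- a", folded a_def b_def]
    by (smt (verit) zero_le_power2)
  then have "0 \<le> (a * b) * (a * b - Re (ip f g))"
    by (simp add: power2_eq_square algebra_simps)
  then have "Re (ip f g) \<le> a * b"
    using ab by (simp add: zero_le_mult_iff)
  then show ?thesis by (simp add: a_def b_def)
qed

lemma hnorm_triangle:
  assumes "f \<in> H" "g \<in> H"
  shows "hnorm ip (\<lambda>x. f x + g x) \<le> hnorm ip f + hnorm ip g"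
proof (rule power2_le_imp_le)
  show "(hnorm ip (\<lambda>x. f x + g x))\<^sup>2 \<le> (hnorm ip f + hnorm ip g)\<^sup>2"
    using hnorm_square_combination[OF assms, of 1 1] Re_ip_le[OF assms]
    by (simp add: power2_sum)
qed (use assms hnorm_nonneg in simp)

lemma hnorm_minus_commute:
  assumes "f \<in> H" "g \<in> H"
  shows "hnorm ip (\<lambda>x. f x - g x) = hnorm ip (\<lambda>x. g x - f x)"
proof -
  define d where "d = (\<lambda>x. g x - f x)"
  have d: "d \<in> H" using diff_mem[OF assms(2,1)] by (simp add: d_def)
  have "(\<lambda>x. f x - g x) = (\<lambda>x. (-1) * d x)" by (auto simp: d_def)
  moreover have "ip (\<lambda>x. (-1) * d x) (\<lambda>x. (-1) * d x) = ip d d"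
    by (subst ip_scale[OF d scale_mem[OF d]], subst ip_scale_right[OF d d]) simp
  ultimately show ?thesis by (simp only: hnorm_def flip: d_def)
qed

end

sublocale inner_function_space \<subseteq> Metric_space H "hdist H ip"
proof
  show "0 \<le> hdist H ip f g" for f g
    by (simp add: hdist_def hnorm_nonneg diff_mem)
  show "hdist H ip f g = hdist H ip g f" for f g
    by (auto simp: hdist_def intro: hnorm_minus_commute)
  show "hdist H ip f g = 0 \<longleftrightarrow> f = g" if "f \<in> H" "g \<in> H" for f g
    using that by (auto simp: hdist_def hnorm_eq_0_iff diff_mem fun_eq_iff)
  show "hdist H ip f k \<le> hdist H ip f g + hdist H ip g k" if "f \<in> H" "g \<in> H" "k \<in> H" for f g k
    using that hnorm_triangle[OF diff_mem[of f g] diff_mem[of g k]]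
    by (simp add: hdist_def)
qed

definition kernel_element ::
    "('a \<Rightarrow> complex) set \<Rightarrow> 'a inner \<Rightarrow> 'a \<Rightarrow> ('a \<Rightarrow> complex)" where
  "kernel_element H ip x = (THE k. k \<in> H \<and> (\<forall>f\<in>H. f x = ip f k))"

definition reproducing_kernel ::
    "('a \<Rightarrow> complex) set \<Rightarrow> 'a inner \<Rightarrow> 'a \<Rightarrow> 'a \<Rightarrow> complex" where
  "reproducing_kernel H ip x y = kernel_element H ip y x"

locale rkhs = inner_function_space +
  assumes complete: "Metric_space.mcomplete H (hdist H ip)"
    and evaluation_continuous: "x \<in> X \<Longrightarrow> continuous_map (htopology H ip) euclidean (\<lambda>f. f x)"
    and kernel_diagonal_pos:
      "x \<in> X \<Longrightarrow> reproducing_kernel H ip x x \<in> \<real> \<and> 0 < Re (reproducing_kernel H ip x x)"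

definition normalized_kernel :: "'a set \<Rightarrow> ('a \<Rightarrow> 'a \<Rightarrow> complex) \<Rightarrow> bool" where
  "normalized_kernel X K \<longleftrightarrow> (\<exists>x0\<in>X. \<forall>x\<in>X. K x x0 = 1)"

definition multipliers :: "'a set \<Rightarrow> ('a \<Rightarrow> complex) set \<Rightarrow> ('a \<Rightarrow> complex) set" where
  "multipliers X H = {h \<in> funs_on X. \<forall>f\<in>H. (\<lambda>x. h x * f x) \<in> H}"

definition cyclic_element ::
    "'a set \<Rightarrow> ('a \<Rightarrow> complex) set \<Rightarrow> 'a inner \<Rightarrow> ('a \<Rightarrow> complex) \<Rightarrow> bool" where
  "cyclic_element X H ip f \<longleftrightarrow>
     f \<in> H \<and> htopology H ip closure_of {\<lambda>x. h x * f x | h. h \<in> multipliers X H} = H"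

definition linear_functional_on ::
    "('a \<Rightarrow> complex) set \<Rightarrow> (('a \<Rightarrow> complex) \<Rightarrow> complex) \<Rightarrow> bool" where
  "linear_functional_on H \<Lambda> \<longleftrightarrow>
     (\<forall>f\<in>H. \<forall>g\<in>H. \<Lambda> (\<lambda>x. f x + g x) = \<Lambda> f + \<Lambda> g) \<and>
     (\<forall>c. \<forall>f\<in>H. \<Lambda> (\<lambda>x. c * f x) = c * \<Lambda> f)"

end

theory Submission
  imports Defs
begin

text \<open>
  Let \<open>H\<close> be the span on \<open>X = {0, 1, 2, 3}\<close> of \<open>1\<close>, \<open>a = (0, 1, 2, 0)\<close> and \<open>b = (0, 0, 0, 1)\<close>, made
  an orthonormal basis; the kernel is \<open>1 + a(x) a(y) + b(x) b(y)\<close>, which is positive, and is \<open>1\<close> for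
  \<open>y = 0\<close>.  If \<open>h\<close> is a multiplier, then \<open>h\<close> and \<open>h a\<close> are both affine along the points \<open>0, 1, 2\<close>,
  which forces \<open>h\<close> to be constant there.  Hence on \<open>{0, 1, 2}\<close> all elements of \<open>\<M>f\<close> are
  proportional to \<open>f\<close>, while \<open>H\<close> restricts to a two-dimensional space: there are no cyclic
  elements, and the condition on \<open>\<Lambda>\<close> is vacuous.  The functional \<open>\<Lambda> f = (f(0) + f(3)) / 2\<close> is not
  multiplicative on the idempotent multiplier \<open>b\<close>.
\<close>

context inner_function_space
begin

lemma topspace_htopology: "topspace (htopology H ip) = H"
  by (simp add: htopology_def)

text \<open>Two elements of \<open>H\<close> that represent the same evaluation differ by some
  \<open>d\<close> with \<open>ip d d = 0\<close>. So exhibiting one representing element is enough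
  to compute the definite description.\<close>

lemma kernel_element_eqI:
  assumes k: "k \<in> H" and rep: "\<And>f. f \<in> H \<Longrightarrow> f x = ip f k"
  shows "kernel_element H ip x = k"
  unfolding kernel_element_def
proof (rule the_equality)
  fix l assume l: "l \<in> H \<and> (\<forall>f\<in>H. f x = ip f l)"
  define d where "d = (\<lambda>y. l y - k y)"
  have d: "d \<in> H" using l k by (simp add: d_def diff_mem)
  have "ip d l = ip d d + ip d k"
    using ip_add_right[OF d k d] by (simp add: d_def)
  moreover have "ip d l = ip d k" using rep[OF d] l d by simp
  ultimately have "d = (\<lambda>_. 0)" using ip_pos[OF d] by auto
  then show "l = k" by (auto simp: d_def fun_eq_iff)
qed (use assms in auto)

text \<open>Such a functional is 1-Lipschitz. The constant 1 suffices here, since it will be applied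
  to coefficients in an orthonormal basis.\<close>

lemma continuous_map_bounded_functional:
  assumes diff: "\<And>f g. f \<in> H \<Longrightarrow> g \<in> H \<Longrightarrow> L (\<lambda>x. f x - g x) = L f - (L g :: complex)"
    and bound: "\<And>f. f \<in> H \<Longrightarrow> norm (L f) \<le> hnorm ip f"
  shows "continuous_map (htopology H ip) euclidean L"
  unfolding htopology_def metric_continuous_map[OF Met_TC.Metric_space_axioms,
      unfolded mtopology_is_euclidean]
proof (intro conjI ballI allI impI)
  fix f and e :: real assume f: "f \<in> H" and e: "0 < e"
  have "dist (L f) (L g) < e" if "g \<in> H" "hdist H ip f g < e" for g
    using bound[OF diff_mem[OF f that(1)]] that f by (simp add: hdist_def dist_norm diff)
  then show "\<exists>\<delta>>0. \<forall>g. g \<in> H \<and> hdist H ip f g < \<delta> \<longrightarrow> dist (L f) (L g) < e"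
    using e by blast
qed simp

end

definition four_points :: "complex set" where
  "four_points = {0, 1, 2, 3}"

definition affine_functions :: "(complex \<Rightarrow> complex) set" where
  "affine_functions = {f \<in> funs_on four_points. f 2 = 2 * f 1 - f 0}"

text \<open>The numbers \<open>f 0\<close>, \<open>f 1 - f 0\<close>, \<open>f 3 - f 0\<close> are
  the coefficients of \<open>f\<close> in the basis \<open>one_on four_points\<close>,
  \<open>slope_function\<close>, \<open>point_function\<close>, which this inner product makes
  orthonormal.\<close>

definition coordinate_inner :: "complex inner" where
  "coordinate_inner f g =
     f 0 * cnj (g 0) + (f 1 - f 0) * cnj (g 1 - g 0) + (f 3 - f 0) * cnj (g 3 - g 0)"

definition slope_function :: "complex \<Rightarrow> complex" where
  "slope_function x = (if x = 1 then 1 else if x = 2 then 2 else 0)"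

definition point_function :: "complex \<Rightarrow> complex" where
  "point_function x = (if x = 3 then 1 else 0)"

text \<open>The base point comes first, so that \<open>four_point_kernel y\<close> is the kernel
  element at \<open>y\<close>. Conjugates are absent because the basis functions are
  real-valued.\<close>

definition four_point_kernel :: "complex \<Rightarrow> complex \<Rightarrow> complex" where
  "four_point_kernel y x = (if x \<in> four_points
     then 1 + slope_function x * slope_function y + point_function x * point_function y else 0)"

lemma affine_functions_eqI:
  assumes "f \<in> affine_functions" "g \<in> affine_functions" "f 0 = g 0" "f 1 = g 1" "f 3 = g 3"
  shows "f = g"
proof
  fix x
  show "f x = g x"
    using assms by (cases "x \<in> four_points")
      (auto simp: affine_functions_def funs_on_def four_points_def)
qed

lemma Re_coordinate_inner_self:
  "Re (coordinate_inner f f) = (norm (f 0))\<^sup>2 + (norm (f 1 - f 0))\<^sup>2 + (norm (f 3 - f 0))\<^sup>2"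
  unfolding cmod_power2 by (simp add: coordinate_inner_def power2_eq_square algebra_simps)

interpretation four: inner_function_space four_points affine_functions coordinate_inner
proof
  show "(\<lambda>x. c * f x) \<in> affine_functions" if "f \<in> affine_functions" for c f
    using that by (simp add: affine_functions_def funs_on_def right_diff_distrib)
next
  fix f :: "complex \<Rightarrow> complex"
  assume f: "f \<in> affine_functions" "f \<noteq> (\<lambda>_. 0)"
  have "(\<lambda>_. 0) \<in> affine_functions" by (simp add: affine_functions_def funs_on_def)
  then have "f 0 \<noteq> 0 \<or> f 1 \<noteq> 0 \<or> f 3 \<noteq> 0"
    using affine_functions_eqI[OF f(1)] f(2) by force
  then have "norm (f 0) \<noteq> 0 \<or> norm (f 1 - f 0) \<noteq> 0 \<or> norm (f 3 - f 0) \<noteq> 0"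
    by auto
  then show "0 < Re (coordinate_inner f f)"
    unfolding Re_coordinate_inner_self
    by (smt (verit) zero_le_power2 zero_less_power2)
qed (auto simp: affine_functions_def funs_on_def coordinate_inner_def algebra_simps)

lemma hnorm_coordinate:
  "hnorm coordinate_inner f =
     sqrt ((norm (f 0))\<^sup>2 + (norm (f 1 - f 0))\<^sup>2 + (norm (f 3 - f 0))\<^sup>2)"
  by (simp add: hnorm_def Re_coordinate_inner_self)

lemma coordinate_le_hnorm:
  "norm (f 0) \<le> hnorm coordinate_inner f"
  "norm (f 1 - f 0) \<le> hnorm coordinate_inner f"
  "norm (f 3 - f 0) \<le> hnorm coordinate_inner f"
  by (auto simp: hnorm_coordinate intro!: real_le_rsqrt)

lemma continuous_map_evaluation:
  assumes "x \<in> four_points"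
  shows "continuous_map (htopology affine_functions coordinate_inner) euclidean
    (\<lambda>f. f x :: complex)"
proof -
  let ?T = "htopology affine_functions coordinate_inner"
  have c0: "continuous_map ?T euclidean (\<lambda>f. f 0)"
    by (rule four.continuous_map_bounded_functional) (auto simp: coordinate_le_hnorm)
  have "continuous_map ?T euclidean (\<lambda>f. f 1 - f 0)"
    by (rule four.continuous_map_bounded_functional) (auto simp: coordinate_le_hnorm)
  from continuous_map_add[OF this c0] have c1: "continuous_map ?T euclidean (\<lambda>f. f 1)" by simp
  have "continuous_map ?T euclidean (\<lambda>f. f 3 - f 0)"
    by (rule four.continuous_map_bounded_functional) (auto simp: coordinate_le_hnorm)
  from continuous_map_add[OF this c0] have c3: "continuous_map ?T euclidean (\<lambda>f. f 3)" by simp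
  \<comment> \<open>Evaluation at 2 agrees with this combination on the space, by its defining
    relation.\<close>
  have "continuous_map ?T euclidean (\<lambda>f. (f 1 + f 1) - f 0)"
    by (intro continuous_map_diff continuous_map_add c0 c1)
  then have c2: "continuous_map ?T euclidean (\<lambda>f. f 2)"
    by (rule continuous_map_eq) (simp only: four.topspace_htopology, simp add: affine_functions_def)
  show ?thesis using assms c0 c1 c2 c3 by (auto simp: four_points_def)
qed

text \<open>Each coefficient is bounded by the norm, so the coefficients of a Cauchy sequence
  converge in the complex numbers. Distance is the Euclidean distance of coefficient triples, so the
  function with the limiting coefficients is the limit.\<close>

lemma mcomplete_affine_functions:
  "Metric_space.mcomplete affine_functions (hdist affine_functions coordinate_inner)"
  unfolding four.mcomplete_def
proof (intro allI impI)
  fix s assume "four.MCauchy s"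
  then have s: "\<And>n. s n \<in> affine_functions"
    and N: "\<And>e. 0 < e \<Longrightarrow> \<exists>N. \<forall>n n'. N \<le> n \<longrightarrow> N \<le> n' \<longrightarrow>
      hdist affine_functions coordinate_inner (s n) (s n') < e"
    by (auto simp: four.MCauchy_def)
  have lim: "\<exists>l. (\<lambda>n. L (s n)) \<longlonglongrightarrow> l"
    if diff: "\<And>f g. L (\<lambda>x. f x - g x) = L f - L g"
      and bound: "\<And>f. norm (L f) \<le> hnorm coordinate_inner f" for L :: "_ \<Rightarrow> complex"
  proof -
    have "norm (L (s n) - L (s n')) \<le> hdist affine_functions coordinate_inner (s n) (s n')" for n n'
      using bound[of "\<lambda>x. s n x - s n' x"] s by (simp add: hdist_def diff)
    then have "Cauchy (\<lambda>n. L (s n))"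
      unfolding Cauchy_def dist_norm using N by (meson le_less_trans)
    then show ?thesis by (simp add: Cauchy_convergent_iff convergent_def)
  qed
  obtain p q r where p: "(\<lambda>n. s n 0) \<longlonglongrightarrow> p" and q: "(\<lambda>n. s n 1 - s n 0) \<longlonglongrightarrow> q"
    and r: "(\<lambda>n. s n 3 - s n 0) \<longlonglongrightarrow> r"
    using lim[of "\<lambda>f. f 0"] lim[of "\<lambda>f. f 1 - f 0"] lim[of "\<lambda>f. f 3 - f 0"]
    by (auto simp: coordinate_le_hnorm)
  define f where "f x = (if x \<in> four_points
    then p + slope_function x * q + point_function x * r else 0)" for x
  have f: "f \<in> affine_functions" and f_eq: "f 0 = p" "f 1 - f 0 = q" "f 3 - f 0 = r"
    by (auto simp: f_def affine_functions_def funs_on_def four_points_def slope_function_def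
        point_function_def)
  have *: "hdist affine_functions coordinate_inner (s n) f =
      sqrt ((norm (s n 0 - p))\<^sup>2 + (norm ((s n 1 - s n 0) - q))\<^sup>2 + (norm ((s n 3 - s n 0) - r))\<^sup>2)"
    for n
    unfolding f_eq[symmetric] using s f by (simp add: hdist_def hnorm_coordinate algebra_simps)
  \<comment> \<open>The limit is zero, left in the shape that the limit rules produce.\<close>
  have "(\<lambda>n. hdist affine_functions coordinate_inner (s n) f) \<longlonglongrightarrow>
      sqrt ((norm (p - p))\<^sup>2 + (norm (q - q))\<^sup>2 + (norm (r - r))\<^sup>2)"
    unfolding * by (intro tendsto_intros p q r)
  then show "\<exists>f. limitin four.mtopology s f sequentially"
    using s f by (auto simp: four.limitin_metric_dist_null)
qed

lemma reproducing_kernel_four_points: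
  assumes "y \<in> four_points"
  shows "reproducing_kernel affine_functions coordinate_inner x y = four_point_kernel y x"
proof -
  have "kernel_element affine_functions coordinate_inner y = four_point_kernel y"
  proof (rule four.kernel_element_eqI)
    show "four_point_kernel y \<in> affine_functions"
      by (auto simp: four_point_kernel_def affine_functions_def funs_on_def four_points_def
          slope_function_def point_function_def)
    show "f y = coordinate_inner f (four_point_kernel y)" if "f \<in> affine_functions" for f
      using assms that by (auto simp: four_point_kernel_def affine_functions_def four_points_def
          slope_function_def point_function_def coordinate_inner_def)
  qed
  then show ?thesis by (simp add: reproducing_kernel_def)
qed

text \<open>The basis functions take only nonnegative values, so the kernel is at least 1. This
  gives both the positive diagonal and the absence of zeros.\<close>

lemma four_point_kernel_pos:
  assumes "x \<in> four_points" "y \<in> four_points"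
  shows "four_point_kernel y x \<in> \<real>" "0 < Re (four_point_kernel y x)"
  using assms by (auto simp: four_point_kernel_def four_points_def
      slope_function_def point_function_def)

lemma rkhs_four_points: "rkhs four_points affine_functions coordinate_inner"
  by unfold_locales (auto simp: mcomplete_affine_functions continuous_map_evaluation
      reproducing_kernel_four_points four_point_kernel_pos)

text \<open>Multiplying the constant one by \<open>h\<close> gives
  \<open>h 2 = 2 * h 1 - h 0\<close>, and multiplying \<open>slope_function\<close> gives
  \<open>2 * h 2 = 2 * h 1\<close>.\<close>

lemma multipliers_affine_functions:
  assumes "h \<in> multipliers four_points affine_functions"
  shows "h 1 = h 0"
proof -
  have "one_on four_points \<in> affine_functions" "slope_function \<in> affine_functions"
    by (auto simp: one_on_def affine_functions_def funs_on_def four_points_def slope_function_def)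
  with assms have "(\<lambda>x. h x * one_on four_points x) \<in> affine_functions"
    "(\<lambda>x. h x * slope_function x) \<in> affine_functions"
    by (auto simp: multipliers_def)
  then show ?thesis
    by (auto simp: affine_functions_def one_on_def four_points_def slope_function_def)
qed

lemma no_cyclic_element:
  "\<not> cyclic_element four_points affine_functions coordinate_inner f"
proof
  let ?T = "htopology affine_functions coordinate_inner"
  let ?S = "{\<lambda>x. h x * f x | h. h \<in> multipliers four_points affine_functions}"
  \<comment> \<open>The determinant condition says that \<open>g\<close> and \<open>f\<close> are
    linearly dependent on the points 0 and 1. It is closed and holds for all \<open>h f\<close>,
    because \<open>h 1 = h 0\<close>.\<close>
  let ?Z = "{g \<in> topspace ?T. f 0 * g 1 - f 1 * g 0 \<in> {0}}"
  assume cyc: "cyclic_element four_points affine_functions coordinate_inner f"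
  have cont: "continuous_map ?T euclidean (\<lambda>g. c * g x)" if "x \<in> four_points" for c x
    using continuous_map_compose[OF continuous_map_evaluation[OF that],
        of euclidean "\<lambda>z. c * z"]
    by (simp add: o_def continuous_on_mult_left)
  have "continuous_map ?T euclidean (\<lambda>g. f 0 * g 1 - f 1 * g 0)"
    by (intro continuous_map_diff cont) (auto simp: four_points_def)
  then have "closedin ?T ?Z"
    by (rule closedin_continuous_map_preimage) simp
  moreover have "?S \<subseteq> ?Z"
    using cyc multipliers_affine_functions
    by (auto simp: four.topspace_htopology cyclic_element_def multipliers_def)
  ultimately have Z: "affine_functions \<subseteq> ?Z"
    using cyc closure_of_minimal[of ?S ?Z ?T] by (simp add: cyclic_element_def)
  have "one_on four_points \<in> affine_functions" "slope_function \<in> affine_functions"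
    by (auto simp: one_on_def affine_functions_def funs_on_def four_points_def slope_function_def)
  \<comment> \<open>If the whole space satisfies the condition, the constant one forces
    \<open>f 0 = f 1\<close> and \<open>slope_function\<close> forces
    \<open>f 0 = 0\<close>.\<close>
  with Z have "one_on four_points \<in> ?Z" "slope_function \<in> ?Z" by blast+
  then have "f 0 = 0" "f 1 = 0"
    by (auto simp: one_on_def four_points_def slope_function_def)
  \<comment> \<open>In the remaining case every \<open>h f\<close> vanishes at 0. This is again a
    closed condition, and the constant one violates it.\<close>
  define E where "E = {g \<in> topspace ?T. g 0 \<in> {0 :: complex}}"
  have "continuous_map ?T euclidean (\<lambda>g. g 0)"
    by (rule continuous_map_evaluation) (simp add: four_points_def)
  then have "closedin ?T E"
    unfolding E_def by (rule closedin_continuous_map_preimage) simp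
  moreover have "?S \<subseteq> E"
    using cyc \<open>f 0 = 0\<close>
    by (auto simp: E_def four.topspace_htopology cyclic_element_def multipliers_def)
  ultimately have "affine_functions \<subseteq> E"
    using cyc closure_of_minimal[of ?S E ?T] by (simp add: cyclic_element_def)
  with \<open>one_on four_points \<in> affine_functions\<close> have "one_on four_points \<in> E" by blast
  then show False by (simp add: E_def one_on_def four_points_def)
qed

text \<open>A product with \<open>point_function\<close> vanishes at 0, 1 and 2, where the affine
  relation lives, and the value at 3 is unconstrained.\<close>

lemma point_function_multiplier: "point_function \<in> multipliers four_points affine_functions"
  by (auto simp: multipliers_def point_function_def affine_functions_def funs_on_def
      four_points_def)

theorem proposition5p1:
  shows "\<exists>(X :: complex set) (H :: (complex \<Rightarrow> complex) set) (ip :: complex inner)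
      (\<Lambda> :: (complex \<Rightarrow> complex) \<Rightarrow> complex).
    rkhs X H ip \<and> linear_functional_on H \<Lambda> \<and>
    normalized_kernel X (reproducing_kernel H ip) \<and>
    (\<forall>x\<in>X. \<forall>y\<in>X. reproducing_kernel H ip x y \<noteq> 0) \<and>
    \<Lambda> (one_on X) = 1 \<and>
    (\<forall>f. cyclic_element X H ip f \<longrightarrow> \<Lambda> f \<noteq> 0) \<and>
    continuous_map (htopology H ip) euclidean \<Lambda> \<and>
    (\<exists>h\<in>multipliers X H. \<Lambda> (\<lambda>x. (h x)\<^sup>2) \<noteq> (\<Lambda> h)\<^sup>2)"
proof (intro exI conjI)
  let ?\<Lambda> = "\<lambda>f :: complex \<Rightarrow> complex. (f 0 + f 3) / 2"
  let ?T = "htopology affine_functions coordinate_inner"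
  show "rkhs four_points affine_functions coordinate_inner" by (rule rkhs_four_points)
  show "linear_functional_on affine_functions ?\<Lambda>"
    by (simp add: linear_functional_on_def algebra_simps add_divide_distrib)
  \<comment> \<open>The base point is 0, where \<open>slope_function\<close> and
    \<open>point_function\<close> both vanish.\<close>
  show "normalized_kernel four_points (reproducing_kernel affine_functions coordinate_inner)"
    unfolding normalized_kernel_def
    by (rule bexI[of _ 0]) (auto simp: reproducing_kernel_four_points four_point_kernel_def
        four_points_def slope_function_def point_function_def)
  show "\<forall>x\<in>four_points. \<forall>y\<in>four_points.
      reproducing_kernel affine_functions coordinate_inner x y \<noteq> 0"
    using four_point_kernel_pos(2) by (force simp: reproducing_kernel_four_points)
  show "?\<Lambda> (one_on four_points) = 1" by (simp add: one_on_def four_points_def)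
  show "\<forall>f. cyclic_element four_points affine_functions coordinate_inner f \<longrightarrow> ?\<Lambda> f \<noteq> 0"
    by (simp add: no_cyclic_element)
  have "continuous_map ?T euclidean (\<lambda>f. f 0 + f 3)"
    by (intro continuous_map_add continuous_map_evaluation) (auto simp: four_points_def)
  from continuous_map_compose[OF this, of euclidean "\<lambda>z. z / 2"]
  show "continuous_map ?T euclidean ?\<Lambda>" by (simp add: o_def continuous_on_divide)
  \<comment> \<open>For \<open>point_function\<close> the two sides are 1/2 and 1/4.\<close>
  show "\<exists>h\<in>multipliers four_points affine_functions. ?\<Lambda> (\<lambda>x. (h x)\<^sup>2) \<noteq> (?\<Lambda> h)\<^sup>2"
    by (rule bexI[OF _ point_function_multiplier])
      (simp add: point_function_def power2_eq_square)
qed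

end
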